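(* Let $r\in\mathbb N$, $d_1,\dots,d_r>0$, $\tau>0$, and let $f=(f_1,\dots,f_r)$ be the reaction kinetics. Let the triangulation $\mathcal K_h$ satisfy the angle condition $\alpha_1+\alpha_2\le\pi$ for every edge. Let $\Sigma=\prod_{k=1}^r[m_k,M_k]$ be a hyper-rectangle in the phase space $\mathbb R^r$ such that $$f(u)\cdot\mathbf n(u)\le0\qquad\forall\,u\in\partial\Sigma,$$ where $\mathbf n$ is the outward unit normal defined piecewise on $\partial\Sigma$. For all $k=1,\dots,r$, let $L_k$ be the Lipschitz constant of $f_k$ on $\Sigma$. If $$\tau\le\frac1{\max_{k=1,\dots,r}L_k},$$ then $\Sigma$ is an invariant region for the scheme $$\xi_k^{n+1}=(\bar M+d_k\tau A)^{-1}\bar M\big(\xi_k^n+\tau f_k(\xi_1^n,\dots,\xi_r^n)\big),\qquad k=1,\dots,r,\ n\in\mathbb N\cup\{0\},$$ where $\xi_k^n=(\xi_{k,1}^n,\dots,\xi_{k,N}^n)^T\in\mathbb R^N$; that is, if $(\xi^0_{1,i},\dots,\xi^0_{r,i})\in\Sigma$ for all $i=1,\dots,N$, then $(\xi^n_{1,i},\dots,\xi^n_{r,i})\in\Sigma$ for all $i=1,\dots,N$ and all $n\in\mathbb N$.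
   Context: $\Gamma\subset\mathbb R^3$ is a compact, orientable, smooth surface without boundary, given as the zero level set of a sufficiently smooth signed distance function $\mathsf d$ defined on an open neighbourhood $W$ of $\Gamma$ with $\nabla\mathsf d\neq 0$ on $W$; its unit normal is $\nu=\nabla \mathsf d/|\nabla\mathsf d|$, and every $x\in W$ is uniquely written as $x=a(x)+\mathsf d(x)\nu(a(x))$ with $a(x)\in\Gamma$. For $h>0$, $\Gamma_h=\bigcup_{K\in\mathcal K_h}K\subset W$ is a closed triangulated surface, where $\mathcal K_h$ is a finite (conforming) set of non-degenerate triangles with diameters at most $h$, whose vertices $x_1,\dots,x_N$ lie on $\Gamma$, and such that $a|_{\Gamma_h}$ is a one-to-one map between $\Gamma_h$ and $\Gamma$. $S_h$ is the space of continuous functions on $\Gamma_h$ that are affine on each $K\in\mathcal K_h$, with nodal basis $\chi_1,\dots,\chi_N$, $\chi_i(x_j)=\delta_{ij}$. For continuous $v$ on $\Gamma_h$, $I_h(v)=\sum_i v(x_i)\chi_i$. $\nabla_{\Gamma_h}$ is the (trianglewise) tangential gradient. Lumped mass matrix: $\bar M=(\bar m_{ij})$, $\bar m_{ij}=\int_{\Gamma_h}I_h(\chi_i\chi_j)$. Stiffness matrix: $A=(a_{ij})$, $a_{ij}=\int_{\Gamma_h}\nabla_{\Gamma_h}\chi_i\cdot\nabla_{\Gamma_h}\chi_j$. The vector $f_k(\xi_1,\dots,\xi_r)\in\mathbb R^N$ is taken nodewise: its $i$-th component is $f_k(\xi_{1,i},\dots,\xi_{r,i})$. Angle condition: for every edge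 $e$ of $\mathcal K_h$, if $K_1,K_2$ are the two triangles sharing $e$ and $\alpha_1,\alpha_2$ are the angles of $K_1,K_2$ opposite to $e$, then $\alpha_1+\alpha_2\le\pi$. The kinetics $f_k:\mathbb R^r\to\mathbb R$ are of class $C^2$, and each $f_k$ is Lipschitz on $\Sigma$. Hyper-rectangles may be bounded or unbounded: $m_k,M_k\in\mathbb R\cup\{-\infty,+\infty\}$. The normal being defined piecewise means that the flux condition is imposed on every face of $\Sigma$: $f_k(u)\le0$ whenever $u\in\Sigma$, $u_k=M_k$, and $f_k(u)\ge0$ whenever $u\in\Sigma$, $u_k=m_k$. If all $L_k=0$ there is no restriction on $\tau$. *)

theory Defs
  imports "HOL-Analysis.Analysis"
begin

primrec C_diff_on :: "nat \<Rightarrow> ('a::euclidean_space \<Rightarrow> real) \<Rightarrow> 'a set \<Rightarrow> bool" where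
  "C_diff_on 0 g S \<longleftrightarrow> continuous_on S g"
| "C_diff_on (Suc n) g S \<longleftrightarrow>
     (\<forall>x\<in>S. g differentiable (at x)) \<and>
     (\<forall>b\<in>Basis. C_diff_on n (\<lambda>x. frechet_derivative g (at x) b) S)"

definition gradient :: "('a::real_inner \<Rightarrow> real) \<Rightarrow> 'a \<Rightarrow> 'a" where
  "gradient g x = (THE D. GDERIV g x :> D)"

definition unit_normal :: "('a::real_inner \<Rightarrow> real) \<Rightarrow> 'a \<Rightarrow> 'a" where
  "unit_normal sd x = gradient sd x /\<^sub>R norm (gradient sd x)"

(* A regular zero level set contained in an open set is automatically a surface without boundary,
   oriented by the normalised gradient. The two sides of the surface carry opposite signs of sd
   because the gradient does not vanish. *)
definition level_set_surface ::
    "(real^3) set \<Rightarrow> (real^3) set \<Rightarrow> (real^3 \<Rightarrow> real) \<Rightarrow> (real^3 \<Rightarrow> real^3) \<Rightarrow> bool" where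
  "level_set_surface \<Gamma> W sd a \<longleftrightarrow>
     compact \<Gamma> \<and> open W \<and> \<Gamma> = {x\<in>W. sd x = 0} \<and>
     C_diff_on 2 sd W \<and> (\<forall>x\<in>W. gradient sd x \<noteq> 0) \<and>
     (\<forall>x\<in>W. \<bar>sd x\<bar> = infdist x \<Gamma>) \<and>
     (\<forall>x\<in>W. a x \<in> \<Gamma> \<and> x = a x + sd x *\<^sub>R unit_normal sd (a x) \<and>
        (\<forall>y\<in>\<Gamma>. x = y + sd x *\<^sub>R unit_normal sd y \<longrightarrow> y = a x))"

(* The last condition says that the triangles around a vertex form a single fan, so that the
   union is a surface also at the vertices. *)
definition closed_triangulated_surface :: "(real^3) set set \<Rightarrow> bool" where
  "closed_triangulated_surface \<K> \<longleftrightarrow>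
     triangulation \<K> \<and> (\<forall>K\<in>\<K>. 2 simplex K) \<and>
     (\<forall>K\<in>\<K>. \<forall>e. e edge_of K \<longrightarrow> card {K'\<in>\<K>. e edge_of K'} = 2) \<and>
     (\<forall>v. \<forall>K\<in>\<K>. \<forall>K'\<in>\<K>. v extreme_point_of K \<and> v extreme_point_of K' \<longrightarrow>
        (K, K') \<in> {(T, T'). T \<in> \<K> \<and> T' \<in> \<K> \<and> v \<in> T \<inter> T' \<and> (T \<inter> T') edge_of T}\<^sup>*)"

definition surface_mesh ::
    "(real^3) set \<Rightarrow> (real^3) set \<Rightarrow> (real^3 \<Rightarrow> real^3) \<Rightarrow> real \<Rightarrow> (real^3) set set \<Rightarrow>
     ('n::finite \<Rightarrow> real^3) \<Rightarrow> bool" where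
  "surface_mesh \<Gamma> W a h \<K> x \<longleftrightarrow>
     closed_triangulated_surface \<K> \<and> (\<forall>K\<in>\<K>. diameter K \<le> h) \<and> \<Union>\<K> \<subseteq> W \<and>
     inj x \<and> range x = {v. \<exists>K\<in>\<K>. v extreme_point_of K} \<and> range x \<subseteq> \<Gamma> \<and>
     bij_betw a (\<Union>\<K>) \<Gamma>"

definition angle_at :: "'a::real_inner \<Rightarrow> 'a \<Rightarrow> 'a \<Rightarrow> real" where
  "angle_at v p q = arccos (((p - v) \<bullet> (q - v)) / (norm (p - v) * norm (q - v)))"

(* The shared edge e is the segment from p to q; v1 and v2 are the vertices opposite to it. *)
definition angle_condition :: "(real^3) set set \<Rightarrow> bool" where
  "angle_condition \<K> \<longleftrightarrow>
     (\<forall>K1\<in>\<K>. \<forall>K2\<in>\<K>. \<forall>p q v1 v2.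
        K1 \<noteq> K2 \<and> K1 = convex hull {p, q, v1} \<and> K2 = convex hull {p, q, v2} \<longrightarrow>
        angle_at v1 p q + angle_at v2 p q \<le> pi)"

definition fe_space :: "(real^3) set set \<Rightarrow> (real^3 \<Rightarrow> real) set" where
  "fe_space \<K> = {v. continuous_on (\<Union>\<K>) v \<and> (\<forall>K\<in>\<K>. \<exists>c g. \<forall>y\<in>K. v y = c + g \<bullet> y)}"

(* Functions on the discrete surface are represented by total functions whose values off the
   surface are irrelevant; hence the nodal basis is a predicate, and not a single constant. *)
definition nodal_basis ::
    "(real^3) set set \<Rightarrow> ('n::finite \<Rightarrow> real^3) \<Rightarrow> ('n \<Rightarrow> real^3 \<Rightarrow> real) \<Rightarrow> bool" where
  "nodal_basis \<K> x \<phi> \<longleftrightarrow>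
     (\<forall>i. \<phi> i \<in> fe_space \<K>) \<and> (\<forall>i j. \<phi> i (x j) = (if i = j then 1 else 0))"

definition interpolant ::
    "('n::finite \<Rightarrow> real^3) \<Rightarrow> ('n \<Rightarrow> real^3 \<Rightarrow> real) \<Rightarrow> (real^3 \<Rightarrow> real) \<Rightarrow> real^3 \<Rightarrow> real" where
  "interpolant x \<phi> v = (\<lambda>y. \<Sum>i\<in>UNIV. v (x i) * \<phi> i y)"

(* Differentiability is along K only, and the gradient lies in the direction space of K. *)
definition tangential_gradient :: "(real^3) set \<Rightarrow> (real^3 \<Rightarrow> real) \<Rightarrow> real^3 \<Rightarrow> real^3" where
  "tangential_gradient K v y =
     (THE g. g \<in> span {z - z' |z z'. z \<in> K \<and> z' \<in> K} \<and>
             (v has_derivative (\<lambda>w. g \<bullet> w)) (at y within K))"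

(* Surface integral over a triangle, through the affine parametrisation by the unit triangle with
   its area element. The value does not depend on the chosen order of the vertices. *)
definition triangle_integral :: "(real^3) set \<Rightarrow> (real^3 \<Rightarrow> real) \<Rightarrow> real" where
  "triangle_integral K g =
     (let (p, q, r) = (SOME (p, q, r). K = convex hull {p, q, r}) in
      norm (cross3 (q - p) (r - p)) *
      (LINT z:{z. 0 \<le> fst z \<and> 0 \<le> snd z \<and> fst z + snd z \<le> 1}|(lborel :: (real \<times> real) measure).
         g (p + fst z *\<^sub>R (q - p) + snd z *\<^sub>R (r - p))))"

(* The integrand may depend on the triangle, as trianglewise gradients do on common edges. *)
definition surface_integral ::
    "(real^3) set set \<Rightarrow> ((real^3) set \<Rightarrow> real^3 \<Rightarrow> real) \<Rightarrow> real" where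
  "surface_integral \<K> g = (\<Sum>K\<in>\<K>. triangle_integral K (g K))"

definition lumped_mass_matrix ::
    "(real^3) set set \<Rightarrow> ('n::finite \<Rightarrow> real^3) \<Rightarrow> ('n \<Rightarrow> real^3 \<Rightarrow> real) \<Rightarrow> real^'n^'n" where
  "lumped_mass_matrix \<K> x \<phi> =
     (\<chi> i j. surface_integral \<K> (\<lambda>K. interpolant x \<phi> (\<lambda>y. \<phi> i y * \<phi> j y)))"

definition stiffness_matrix ::
    "(real^3) set set \<Rightarrow> ('n::finite \<Rightarrow> real^3 \<Rightarrow> real) \<Rightarrow> real^'n^'n" where
  "stiffness_matrix \<K> \<phi> =
     (\<chi> i j. surface_integral \<K>
        (\<lambda>K y. tangential_gradient K (\<phi> i) y \<bullet> tangential_gradient K (\<phi> j) y))"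

definition hyper_rectangle ::
    "('r::finite \<Rightarrow> ereal) \<Rightarrow> ('r \<Rightarrow> ereal) \<Rightarrow> (real^'r) set" where
  "hyper_rectangle m M = {u. \<forall>k. m k \<le> ereal (u $ k) \<and> ereal (u $ k) \<le> M k}"

(* All outward unit normals of the faces through u: on lower-dimensional faces the piecewise
   normal is multi-valued. *)
definition outward_normals ::
    "('r::finite \<Rightarrow> ereal) \<Rightarrow> ('r \<Rightarrow> ereal) \<Rightarrow> real^'r \<Rightarrow> (real^'r) set" where
  "outward_normals m M u =
     {axis k 1 |k. ereal (u $ k) = M k} \<union> {- axis k 1 |k. ereal (u $ k) = m k}"

definition lipschitz_constant :: "('a::metric_space \<Rightarrow> 'b::metric_space) \<Rightarrow> 'a set \<Rightarrow> real" where
  "lipschitz_constant g S = Inf {L. L-lipschitz_on S g}"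

definition nodal_state :: "('r::finite \<Rightarrow> real^'n) \<Rightarrow> 'n \<Rightarrow> real^'r" where
  "nodal_state \<xi> i = (\<chi> k. \<xi> k $ i)"

definition nodal_reaction ::
    "(real^'r \<Rightarrow> real^'r) \<Rightarrow> ('r::finite \<Rightarrow> real^'n) \<Rightarrow> 'r \<Rightarrow> real^'n" where
  "nodal_reaction f \<xi> k = (\<chi> i. f (nodal_state \<xi> i) $ k)"

end

theory Submission
  imports Defs
begin

text \<open>
  A step of the scheme is an explicit reaction step at every node, followed, separately for
  each component, by the solution of a linear system that discretises diffusion. Both halves keep the
  nodal states in the hyper-rectangle.

  The reaction step does so because the kinetics point inwards on each face, and within a
  distance \<open>\<delta>\<close> from a face the outward speed is at most \<open>L\<close> times \<open>\<delta>\<close>; with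
  \<open>\<tau> * L \<le> 1\<close> the step is therefore too short to reach beyond that face
  (\<open>reaction_step_in_hyper_rectangle\<close>).

  The diffusion step satisfies a discrete maximum principle: each component of the new nodal values
  lies between the least and the greatest of its nodal values after the reaction step
  (\<open>lumped_step_bounds\<close>). This
  rests on the signs and row sums of the matrices. The lumped mass matrix is diagonal with positive entries. The
  stiffness matrix has zero row sums, since the nodal basis functions add up to \<open>1\<close>
  (\<open>stiffness_row_sum\<close>). Its off-diagonal entries are nonpositive (\<open>stiffness_offdiagonal_nonpos\<close>):
  by the cotangent formula the entry of the end points of an edge is
  \<open>- (cot \<alpha> + cot \<beta>) / 2 = - sin (\<alpha> + \<beta>) / (2 * sin \<alpha> * sin \<beta>)\<close> with \<open>\<alpha>\<close>, \<open>\<beta>\<close> the two angles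
  opposite to that edge, and \<open>\<alpha> + \<beta> \<le> pi\<close> by the angle condition. No bound on the time step arises
  from diffusion.
\<close>

section \<open>Reaction steps in a hyper-rectangle\<close>

text \<open>The infimum of all Lipschitz constants is attained, because each defining inequality is closed in
  the constant.\<close>

lemma lipschitz_on_lipschitz_constant:
  assumes "\<exists>C. C-lipschitz_on S g"
  shows "(lipschitz_constant g S)-lipschitz_on S g"
proof (rule lipschitz_onI)
  let ?Ls = "{L. L-lipschitz_on S g}"
  have ne: "?Ls \<noteq> {}" using assms by auto
  show "0 \<le> lipschitz_constant g S"
    unfolding lipschitz_constant_def by (rule cInf_greatest[OF ne]) (auto simp: lipschitz_on_def)
  show "dist (g u) (g v) \<le> lipschitz_constant g S * dist u v" if "u \<in> S" "v \<in> S" for u v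
  proof (cases "u = v")
    case False
    have "dist (g u) (g v) / dist u v \<le> Inf ?Ls"
      using that False
      by (intro cInf_greatest[OF ne]) (auto simp: lipschitz_on_def divide_le_eq)
    then show ?thesis
      using False by (simp add: lipschitz_constant_def divide_le_eq)
  qed simp
qed

text \<open>The flux condition is posed on the topological boundary. An arbitrarily small step across a
  face leaves the hyper-rectangle, so the condition is available at every point of a face, also
  when the hyper-rectangle is degenerate or unbounded.\<close>

lemma hyper_rectangle_face_in_frontier:
  assumes u: "u \<in> hyper_rectangle m M" and face: "ereal (u $ k) = m k \<or> ereal (u $ k) = M k"
  shows "u \<in> frontier (hyper_rectangle m M)"
proof -
  have "u \<notin> interior (hyper_rectangle m M)"
  proof
    assume "u \<in> interior (hyper_rectangle m M)"
    then obtain e where e: "e > 0" "cball u e \<subseteq> hyper_rectangle m M"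
      by (auto simp: mem_interior_cball)
    have "u + s *\<^sub>R axis k 1 \<in> hyper_rectangle m M" if "\<bar>s\<bar> = e" for s
      using that e by (intro subsetD[OF e(2)]) (simp add: dist_norm)
    from this[of e] this[of "-e"] have "ereal (u $ k + e) \<le> M k" "m k \<le> ereal (u $ k - e)"
      using e(1) by (auto simp: hyper_rectangle_def dest!: spec[of _ k])
    moreover have "m k \<le> ereal (u $ k)" "ereal (u $ k) \<le> M k"
      using u by (auto simp: hyper_rectangle_def)
    ultimately show False using face e(1) by (cases "m k"; cases "M k") auto
  qed
  then show ?thesis using u closure_subset by (auto simp: frontier_def)
qed

text \<open>One explicit Euler step of the reaction does not cross the upper face \<open>u $ k = M k\<close>:
  let \<open>u'\<close> be \<open>u\<close> with its \<open>k\<close>-th component moved to \<open>M k\<close>. Then \<open>f u' $ k \<le> 0\<close> by the flux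
  condition, so the Lipschitz bound gives \<open>\<tau> * f u $ k \<le> \<tau> * L * (M k - u $ k) \<le> M k - u $ k\<close>.
  The lower face is symmetric, and an infinite bound imposes nothing. Only the \<open>k\<close>-th component of
  the step is controlled, since the linear systems of the scheme are decoupled in \<open>k\<close>.\<close>

lemma reaction_step_in_hyper_rectangle:
  fixes f :: "real^'r::finite \<Rightarrow> real^'r"
  assumes flux: "\<And>u \<nu>. u \<in> frontier (hyper_rectangle m M) \<Longrightarrow> \<nu> \<in> outward_normals m M u
                   \<Longrightarrow> f u \<bullet> \<nu> \<le> 0"
    and lip: "L-lipschitz_on (hyper_rectangle m M) (\<lambda>u. f u $ k)"
    and \<tau>: "\<tau> > 0" "\<tau> * L \<le> 1"
    and u: "u \<in> hyper_rectangle m M"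
  shows "m k \<le> ereal (u $ k + \<tau> * f u $ k)" "ereal (u $ k + \<tau> * f u $ k) \<le> M k"
proof -
  define pr where "pr b = (\<chi> l. if l = k then b else u $ l)" for b :: real
  have u': "m l \<le> ereal (u $ l)" "ereal (u $ l) \<le> M l" for l
    using u by (auto simp: hyper_rectangle_def)
  have prR: "pr b \<in> hyper_rectangle m M" if "m k \<le> ereal b" "ereal b \<le> M k" for b
    using that u' by (auto simp: hyper_rectangle_def pr_def)
  have step: "\<bar>\<tau> * f u $ k - \<tau> * f (pr b) $ k\<bar> \<le> \<bar>u $ k - b\<bar>"
    if "m k \<le> ereal b" "ereal b \<le> M k" for b
  proof -
    have "u - pr b = (u $ k - b) *\<^sub>R axis k 1"
      by (auto simp: pr_def vec_eq_iff axis_def)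
    then have "dist u (pr b) = \<bar>u $ k - b\<bar>" by (simp add: dist_norm)
    then have "\<bar>f u $ k - f (pr b) $ k\<bar> \<le> L * \<bar>u $ k - b\<bar>"
      using lipschitz_onD[OF lip u prR[OF that]] by (simp add: dist_real_def)
    then have "\<tau> * \<bar>f u $ k - f (pr b) $ k\<bar> \<le> \<tau> * (L * \<bar>u $ k - b\<bar>)"
      using \<tau> by (intro mult_left_mono) auto
    also have "\<dots> \<le> 1 * \<bar>u $ k - b\<bar>"
      unfolding mult.assoc[symmetric] using \<tau> by (intro mult_right_mono) auto
    finally show ?thesis using \<tau> by (simp add: right_diff_distrib[symmetric] abs_mult)
  qed
  show "ereal (u $ k + \<tau> * f u $ k) \<le> M k"
  proof (cases "M k")
    case (real b)
    have b: "m k \<le> ereal b" "ereal b \<le> M k"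
      using u'[of k] real order_trans[OF u'(1)[of k] u'(2)[of k]] by auto
    have "axis k 1 \<in> outward_normals m M (pr b)"
      using real by (auto simp: outward_normals_def pr_def)
    with flux[OF hyper_rectangle_face_in_frontier[OF prR[OF b], of k]] real
    have "f (pr b) $ k \<le> 0" by (force simp: pr_def inner_axis)
    then have "\<tau> * f (pr b) $ k \<le> 0" using \<tau> by (simp add: mult_le_0_iff)
    then show ?thesis using step[OF b] u'(2)[of k] real by auto
  qed (use u'(2)[of k] in auto)
  show "m k \<le> ereal (u $ k + \<tau> * f u $ k)"
  proof (cases "m k")
    case (real b)
    have b: "m k \<le> ereal b" "ereal b \<le> M k"
      using u'[of k] real order_trans[OF u'(1)[of k] u'(2)[of k]] by auto
    have "- axis k 1 \<in> outward_normals m M (pr b)"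
      using real by (auto simp: outward_normals_def pr_def)
    with flux[OF hyper_rectangle_face_in_frontier[OF prR[OF b], of k]] real
    have "f (pr b) $ k \<ge> 0" by (force simp: pr_def inner_axis)
    then have "\<tau> * f (pr b) $ k \<ge> 0" using \<tau> by simp
    then show ?thesis using step[OF b] u'(1)[of k] real by auto
  qed (use u'(1)[of k] in auto)
qed

section \<open>The discrete maximum principle\<close>

text \<open>At a node \<open>k\<close> where \<open>y\<close> is largest, the zero row sum turns
  \<open>(A *v y) $ k\<close> into the sum of the \<open>A $ k $ j * (y $ j - y $ k)\<close>, all of which are products of two
  nonpositive numbers. So the diffusion term is nonnegative there, and the \<open>k\<close>-th
  equation leaves \<open>D $ k $ k * y $ k \<le> D $ k $ k * w $ k\<close>.\<close>

lemma lumped_step_le: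
  fixes D A :: "real^'n^'n"
  assumes diag: "\<And>i. D $ i $ i > 0" "\<And>i j. i \<noteq> j \<Longrightarrow> D $ i $ j = 0"
    and rows: "\<And>i. (\<Sum>j\<in>UNIV. A $ i $ j) = 0" and off: "\<And>i j. i \<noteq> j \<Longrightarrow> A $ i $ j \<le> 0"
    and c: "c \<ge> 0" and eq: "(D + c *\<^sub>R A) *v y = D *v w" and w: "\<And>i. w $ i \<le> b"
  shows "y $ i \<le> b"
proof -
  have "Max (range (\<lambda>j. y $ j)) \<in> range (\<lambda>j. y $ j)" by (intro Max_in) auto
  then obtain k where k: "Max (range (\<lambda>j. y $ j)) = y $ k" unfolding image_iff by blast
  have max: "y $ j \<le> y $ k" for j
    unfolding k[symmetric] by (intro Max_ge) auto
  have D: "(D *v z) $ k = D $ k $ k * z $ k" for z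
    unfolding matrix_vector_mult_def
    by (simp add: sum.remove[of UNIV k] diag(2))
  have "(A *v y) $ k = (\<Sum>j\<in>UNIV. A $ k $ j * (y $ j - y $ k))"
    using rows[of k] by (simp add: matrix_vector_mult_def right_diff_distrib sum_subtractf
        sum_distrib_right[symmetric])
  also have "\<dots> \<ge> 0"
  proof (intro sum_nonneg)
    fix j show "0 \<le> A $ k $ j * (y $ j - y $ k)"
      using off[of k j] max[of j] by (cases "j = k") (auto intro: mult_nonpos_nonpos)
  qed
  finally have "0 \<le> c * (A *v y) $ k" using c by simp
  moreover have "D $ k $ k * y $ k + c * (A *v y) $ k = D $ k $ k * w $ k"
    using arg_cong[OF eq, of "\<lambda>z. z $ k"]
    by (simp add: matrix_vector_mult_add_rdistrib D scaleR_matrix_vector_assoc[symmetric])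
  ultimately have "D $ k $ k * y $ k \<le> D $ k $ k * w $ k" by linarith
  then have "y $ k \<le> w $ k" using diag(1)[of k] by simp
  then show ?thesis using max[of i] w[of k] by linarith
qed

text \<open>The maximum principle for \<open>y\<close> and \<open>- y\<close> gives both bounds; applied with right-hand side \<open>0\<close> it
  also shows that the system matrix is injective, so that \<open>matrix_inv\<close> is a genuine inverse.\<close>

lemma lumped_step_bounds:
  fixes D A :: "real^'n^'n"
  assumes diag: "\<And>i. D $ i $ i > 0" "\<And>i j. i \<noteq> j \<Longrightarrow> D $ i $ j = 0"
    and rows: "\<And>i. (\<Sum>j\<in>UNIV. A $ i $ j) = 0" and off: "\<And>i j. i \<noteq> j \<Longrightarrow> A $ i $ j \<le> 0"
    and c: "c \<ge> 0" and y: "y = matrix_inv (D + c *\<^sub>R A) *v (D *v w)"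
  shows "(\<And>i. w $ i \<le> b) \<Longrightarrow> y $ i \<le> b" "(\<And>i. b \<le> w $ i) \<Longrightarrow> b \<le> y $ i"
proof -
  let ?B = "D + c *\<^sub>R A"
  have max_principle: "z $ i \<le> b" if "?B *v z = D *v w" "\<And>i. w $ i \<le> b" for z w b i
    using lumped_step_le[of D A c z w b i] diag rows off c that by blast
  have "z = 0" if "?B *v z = 0" for z
  proof -
    have "z $ i \<le> 0" "(- z) $ i \<le> 0" for i
      using that max_principle[of z 0 0] max_principle[of "- z" 0 0]
      by (auto simp: linear_neg[OF matrix_vector_mul_linear])
    then show ?thesis by (auto simp: vec_eq_iff intro: antisym)
  qed
  then have "inj ((*v) ?B)"
    by (simp add: matrix_left_invertible_injective[symmetric] matrix_left_invertible_ker)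
  then have "invertible ?B"
    by (simp add: invertible_left_inverse matrix_left_invertible_injective)
  then have inv: "?B ** matrix_inv ?B = mat 1"
    unfolding invertible_def matrix_inv_def by (rule someI2_ex) simp
  have eq: "?B *v y = D *v w"
    unfolding y by (simp add: matrix_vector_mul_assoc[of ?B] inv)
  show "y $ i \<le> b" if "\<And>i. w $ i \<le> b"
    using max_principle[OF eq that] .
  show "b \<le> y $ i" if "\<And>i. b \<le> w $ i"
    using max_principle[of "- y" "- w" "- b" i] that eq
    by (simp add: linear_neg[OF matrix_vector_mul_linear])
qed

section \<open>Integrals over a triangle\<close>

definition ref_triangle :: "(real \<times> real) set" where
  "ref_triangle = {z. 0 \<le> fst z \<and> 0 \<le> snd z \<and> fst z + snd z \<le> 1}"

lemma compact_ref_triangle: "compact ref_triangle"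
proof -
  have "ref_triangle \<subseteq> {0..1} \<times> {0..1}" by (auto simp: ref_triangle_def)
  then have "bounded ref_triangle" by (rule bounded_subset[rotated]) (simp add: bounded_Times)
  moreover have "closed ref_triangle"
    unfolding ref_triangle_def by (intro closed_Collect_conj closed_Collect_le continuous_intros)
  ultimately show ?thesis by (simp add: compact_eq_bounded_closed)
qed

text \<open>\<open>\<alpha>\<close>, \<open>\<beta>\<close>, \<open>\<gamma>\<close> are the values at the three vertices. On a square well inside the
  triangle all barycentric coordinates are at least \<open>1/4\<close>, which bounds the integrand below by
  a positive constant.\<close>

lemma set_integral_ref_triangle_affine_pos:
  fixes \<alpha> \<beta> \<gamma> :: real
  assumes nonneg: "\<alpha> \<ge> 0" "\<beta> \<ge> 0" "\<gamma> \<ge> 0" and pos: "\<alpha> + \<beta> + \<gamma> > 0"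
  shows "(LINT z:ref_triangle|lborel. \<alpha> + (\<beta> - \<alpha>) * fst z + (\<gamma> - \<alpha>) * snd z) > 0"
proof -
  let ?g = "\<lambda>z::real \<times> real. \<alpha> + (\<beta> - \<alpha>) * fst z + (\<gamma> - \<alpha>) * snd z"
  let ?B = "cbox (1/4, 1/4) (1/3, 1/3) :: (real \<times> real) set"
  let ?c = "(\<alpha> + \<beta> + \<gamma>) / 4"
  have lower: "?c * indicator ?B z \<le> indicator ref_triangle z *\<^sub>R ?g z" for z
  proof -
    have g: "?g z = \<alpha> * (1 - fst z - snd z) + \<beta> * fst z + \<gamma> * snd z" by (simp add: algebra_simps)
    show ?thesis
    proof (cases "z \<in> ?B")
      case True
      then have z: "1/4 \<le> fst z" "1/4 \<le> snd z" "1/4 \<le> 1 - fst z - snd z" "z \<in> ref_triangle"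
        by (auto simp: ref_triangle_def cbox_Pair_eq)
      have "\<alpha> * (1/4) + \<beta> * (1/4) + \<gamma> * (1/4) \<le> ?g z"
        unfolding g using z nonneg by (intro add_mono mult_left_mono) auto
      then show ?thesis using True z by simp
    next
      case False
      have "?g z \<ge> 0" if "z \<in> ref_triangle"
        unfolding g using that nonneg 
        by (intro add_nonneg_nonneg mult_nonneg_nonneg) (auto simp: ref_triangle_def)
      then show ?thesis using False by (auto simp: indicator_def)
    qed
  qed
  have "measure lborel ?B > 0"
    by (rule content_pos_lt) (auto simp: Basis_prod_def)
  with pos have "0 < ?c * measure lborel ?B" by simp
  also have "\<dots> = (LINT z|lborel. ?c * indicator ?B z)" by simp
  also have "\<dots> \<le> (LINT z|lborel. indicator ref_triangle z *\<^sub>R ?g z)"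
  proof (rule integral_mono)
    show "integrable lborel (\<lambda>z. ?c * indicator ?B z)"
      using emeasure_lborel_cbox_finite[of "(1/4, 1/4)" "(1/3, 1/3) :: real \<times> real"] by simp
    show "integrable lborel (\<lambda>z. indicator ref_triangle z *\<^sub>R ?g z)"
      by (intro borel_integrable_compact compact_ref_triangle continuous_intros)
  qed (rule lower)
  finally show ?thesis by (simp add: set_lebesgue_integral_def)
qed

lemma set_integral_ref_triangle_const:
  "(LINT z:ref_triangle|lborel. c) = c * measure lborel ref_triangle" for c :: real
  by (simp add: set_lebesgue_integral_def mult.commute)

text \<open>Expanding \<open>(q - p) \<times> (r - p) = p \<times> q + q \<times> r + r \<times> p\<close> shows invariance under cyclic
  permutations; a transposition only changes the sign.\<close>

lemma norm_cross_triangle_permute: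
  fixes p q r :: "real^3"
  assumes "{p, q, r} = {p', q', r'}" "p \<noteq> q" "p \<noteq> r" "q \<noteq> r"
  shows "norm (cross3 (q - p) (r - p)) = norm (cross3 (q' - p') (r' - p'))"
proof -
  have *: "cross3 (b - a) (c - a) = cross3 a b + cross3 b c + cross3 c a" for a b c :: "real^3"
    by (simp add: cross3_simps)
  define N where "N a b c = norm (cross3 (b - a) (c - a))" for a b c :: "real^3"
  have swap: "N a b c = N a c b" for a b c
    unfolding N_def by (metis cross_skew norm_minus_cancel)
  have rot: "N a b c = N b c a" for a b c
    unfolding N_def * by (simp add: ac_simps)
  have "p' \<in> {p, q, r}" "q' \<in> {p, q, r}" "r' \<in> {p, q, r}" "p \<in> {p', q', r'}"
    "q \<in> {p', q', r'}" "r \<in> {p', q', r'}"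
    using assms(1) by auto
  then have "(p', q', r') \<in> {(p, q, r), (p, r, q), (q, p, r), (q, r, p), (r, p, q), (r, q, p)}"
    using assms(2-) by auto
  then consider "(p', q', r') = (p, q, r)" | "(p', q', r') = (p, r, q)" | "(p', q', r') = (q, p, r)"
    | "(p', q', r') = (q, r, p)" | "(p', q', r') = (r, p, q)" | "(p', q', r') = (r, q, p)"
    by blast
  then have "N p q r = N p' q' r'"
    by cases (metis prod.inject swap rot)+
  then show ?thesis by (simp add: N_def)
qed

text \<open>\<open>triangle_integral\<close> parametrises the triangle by an arbitrary choice of vertices. The vertices are
  the extreme points of the triangle, so any such choice is a permutation of a given one, and the
  area element is that of the given one.\<close>

lemma triangle_integral_vertices:
  fixes p q v :: "real^3"
  assumes K: "K = convex hull {p, q, v}" and ind: "\<not> collinear {p, q, v}"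
  obtains p' q' v' where "{p', q', v'} = {p, q, v}"
    "\<And>g. triangle_integral K g = norm (cross3 (p - v) (q - v)) *
       (LINT z:ref_triangle|lborel. g (p' + fst z *\<^sub>R (q' - p') + snd z *\<^sub>R (v' - p')))"
    "\<And>z. z \<in> ref_triangle \<Longrightarrow> p' + fst z *\<^sub>R (q' - p') + snd z *\<^sub>R (v' - p') \<in> K"
proof -
  have distinct: "p \<noteq> q" "p \<noteq> v" "q \<noteq> v" and aff: "\<not> affine_dependent {p, q, v}"
    using ind by (auto simp: collinear_3_eq_affine_dependent)
  obtain p' q' v' where some: "(SOME (p, q, r). K = convex hull {p, q, r}) = (p', q', v')"
    by (metis prod_cases3)
  have "case (SOME (p, q, r). K = convex hull {p, q, r}) of (p, q, r) \<Rightarrow> K = convex hull {p, q, r}"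
    by (rule someI[of _ "(p, q, v)"]) (simp add: K)
  then have K': "K = convex hull {p', q', v'}" by (simp add: some)
  have sub: "{p, q, v} \<subseteq> {p', q', v'}"
    using extreme_point_of_convex_hull_affine_independent[OF aff] extreme_point_of_convex_hull
    unfolding K[symmetric] K' by blast
  have "card {p', q', v'} \<le> card {p, q, v}"
    using distinct by (simp add: card_insert_if)
  then have eq: "{p, q, v} = {p', q', v'}"
    using card_seteq[OF _ sub] by simp
  have "norm (cross3 (q' - p') (v' - p')) = norm (cross3 (q - p) (v - p))"
    using norm_cross_triangle_permute[OF eq] distinct by simp
  also have "\<dots> = norm (cross3 (p - v) (q - v))"
    using norm_cross_triangle_permute[of p q v v p q] distinct by (simp add: insert_commute)
  finally have *: "norm (cross3 (q' - p') (v' - p')) = norm (cross3 (p - v) (q - v))" .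
  have in_K: "p' + fst z *\<^sub>R (q' - p') + snd z *\<^sub>R (v' - p') \<in> K" if "z \<in> ref_triangle" for z
  proof -
    have "p' + fst z *\<^sub>R (q' - p') + snd z *\<^sub>R (v' - p') = (1 - fst z - snd z) *\<^sub>R p' + fst z *\<^sub>R q' + snd z *\<^sub>R v'"
      by (simp add: algebra_simps)
    moreover have "0 \<le> 1 - fst z - snd z" "0 \<le> fst z" "0 \<le> snd z" "1 - fst z - snd z + fst z + snd z = 1"
      using that by (auto simp: ref_triangle_def)
    ultimately show ?thesis unfolding K' convex_hull_3 by blast
  qed
  with * show ?thesis
    using that[of p' q' v'] eq by (simp add: triangle_integral_def some ref_triangle_def)
qed

lemma norm_cross_pos:
  fixes p q v :: "real^3"
  assumes "\<not> collinear {p, q, v}"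
  shows "norm (cross3 (p - v) (q - v)) > 0"
proof -
  have "collinear {p, v, q} \<longleftrightarrow> collinear {0, p - v, q - v}"
    unfolding collinear_def by auto
  with assms show ?thesis by (simp add: cross_eq_0 insert_commute)
qed

lemma triangle_integral_const:
  assumes K: "K = convex hull {p, q, v}" and ind: "\<not> collinear {p, q, v}"
    and g: "\<And>y. y \<in> K \<Longrightarrow> g y = c"
  shows "triangle_integral K g = norm (cross3 (p - v) (q - v)) * (c * measure lborel ref_triangle)"
proof -
  obtain p' q' v' where perm: "{p', q', v'} = {p, q, v}"
    and int: "\<And>g. triangle_integral K g = norm (cross3 (p - v) (q - v)) *
       (LINT z:ref_triangle|lborel. g (p' + fst z *\<^sub>R (q' - p') + snd z *\<^sub>R (v' - p')))"
    and in_K: "\<And>z. z \<in> ref_triangle \<Longrightarrow> p' + fst z *\<^sub>R (q' - p') + snd z *\<^sub>R (v' - p') \<in> K"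
    by (rule triangle_integral_vertices[OF K ind]) blast
  from in_K have "(LINT z:ref_triangle|lborel. g (p' + fst z *\<^sub>R (q' - p') + snd z *\<^sub>R (v' - p'))) =
      (LINT z:ref_triangle|lborel. c)"
    using borel_compact[OF compact_ref_triangle]
    by (intro set_lebesgue_integral_cong) (auto intro: g)
  then show ?thesis by (simp add: int set_integral_ref_triangle_const)
qed

lemma triangle_integral_affine_pos:
  assumes K: "K = convex hull {p, q, v}" and ind: "\<not> collinear {p, q, v}"
    and g: "\<And>y. y \<in> K \<Longrightarrow> g y = c + b \<bullet> y"
    and nonneg: "\<And>z. z \<in> {p, q, v} \<Longrightarrow> g z \<ge> 0" and pos: "z \<in> {p, q, v}" "g z > 0"
  shows "triangle_integral K g > 0"
proof -
  obtain p' q' v' where perm: "{p', q', v'} = {p, q, v}"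
    and int: "\<And>g. triangle_integral K g = norm (cross3 (p - v) (q - v)) *
       (LINT z:ref_triangle|lborel. g (p' + fst z *\<^sub>R (q' - p') + snd z *\<^sub>R (v' - p')))"
    and in_K: "\<And>z. z \<in> ref_triangle \<Longrightarrow> p' + fst z *\<^sub>R (q' - p') + snd z *\<^sub>R (v' - p') \<in> K"
    by (rule triangle_integral_vertices[OF K ind]) blast
  have vert: "p' \<in> K" "q' \<in> K" "v' \<in> K"
    unfolding K perm[symmetric] by (auto intro: hull_inc)
  have "(LINT z:ref_triangle|lborel. g (p' + fst z *\<^sub>R (q' - p') + snd z *\<^sub>R (v' - p'))) =
      (LINT z:ref_triangle|lborel. g p' + (g q' - g p') * fst z + (g v' - g p') * snd z)"
  proof (rule set_lebesgue_integral_cong)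
    show "ref_triangle \<in> sets lborel" using borel_compact[OF compact_ref_triangle] by simp
    show "\<forall>z. z \<in> ref_triangle \<longrightarrow> g (p' + fst z *\<^sub>R (q' - p') + snd z *\<^sub>R (v' - p')) =
        g p' + (g q' - g p') * fst z + (g v' - g p') * snd z"
    proof (intro allI impI)
      fix z assume "z \<in> ref_triangle"
      from g[OF in_K[OF this]] show "g (p' + fst z *\<^sub>R (q' - p') + snd z *\<^sub>R (v' - p')) =
          g p' + (g q' - g p') * fst z + (g v' - g p') * snd z"
        unfolding g[OF vert(1)] g[OF vert(2)] g[OF vert(3)]
        by (simp add: inner_add_right inner_diff_right algebra_simps)
    qed
  qed
  also have "\<dots> > 0"
  proof (rule set_integral_ref_triangle_affine_pos)
    show nn: "g p' \<ge> 0" "g q' \<ge> 0" "g v' \<ge> 0" using nonneg perm by auto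
    have "g p' > 0 \<or> g q' > 0 \<or> g v' > 0" using pos unfolding perm[symmetric] by auto
    then show "g p' + g q' + g v' > 0" using nn by linarith
  qed
  finally show ?thesis using norm_cross_pos[OF ind] by (simp add: int)
qed

section \<open>Tangential gradients of affine functions\<close>

text \<open>A derivative along \<open>K\<close> is determined only in the directions \<open>z - y\<close> with \<open>z \<in> K\<close>; in those it is
  found by restricting to the segment from \<open>y\<close> to \<open>z\<close>, on which \<open>u\<close> is affine.\<close>

lemma has_derivative_within_affine_iff:
  fixes K :: "('a::euclidean_space) set"
  assumes "convex K" and y: "y \<in> K" and u: "\<And>z. z \<in> K \<Longrightarrow> u z = c + b \<bullet> z"
  shows "(u has_derivative (\<lambda>w. G \<bullet> w)) (at y within K) \<longleftrightarrow> (\<forall>z\<in>K. G \<bullet> (z - y) = u z - u y)"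
proof
  assume *: "\<forall>z\<in>K. G \<bullet> (z - y) = u z - u y"
  have "((\<lambda>z. u y + G \<bullet> (z - y)) has_derivative (\<lambda>w. G \<bullet> w)) (at y within K)"
    by (auto intro!: derivative_eq_intros)
  then show "(u has_derivative (\<lambda>w. G \<bullet> w)) (at y within K)"
    by (rule has_derivative_transform[rotated 2]) (use y * in auto)
next
  assume u': "(u has_derivative (\<lambda>w. G \<bullet> w)) (at y within K)"
  show "\<forall>z\<in>K. G \<bullet> (z - y) = u z - u y"
  proof
    fix z assume z: "z \<in> K"
    let ?l = "\<lambda>t::real. y + t *\<^sub>R (z - y)"
    have l: "?l t \<in> K" if "t \<in> cbox 0 1" for t
      using that z y \<open>convex K\<close> unfolding convex_alt by (auto simp: algebra_simps)
    have "((u \<circ> ?l) has_derivative ((\<lambda>w. G \<bullet> w) \<circ> (\<lambda>t. t *\<^sub>R (z - y)))) (at 0 within cbox 0 1)"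
    proof (rule diff_chain_within)
      show "(?l has_derivative (\<lambda>t. t *\<^sub>R (z - y))) (at 0 within cbox 0 1)"
        by (auto intro!: derivative_eq_intros)
      show "(u has_derivative (\<lambda>w. G \<bullet> w)) (at (?l 0) within ?l ` cbox 0 1)"
        using has_derivative_subset[OF u', of "?l ` cbox 0 1"] l by (simp add: image_subset_iff)
    qed
    then have 1: "((u \<circ> ?l) has_vector_derivative (G \<bullet> (z - y))) (at 0 within cbox 0 1)"
      by (simp add: has_vector_derivative_def o_def)
    have "((\<lambda>t. u y + t * (u z - u y)) has_vector_derivative (u z - u y)) (at 0 within cbox 0 1)"
      by (auto intro!: derivative_eq_intros simp: has_vector_derivative_def)
    then have 2: "((u \<circ> ?l) has_vector_derivative (u z - u y)) (at 0 within cbox 0 1)"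
      by (rule has_vector_derivative_transform[rotated 2])
         (use u[OF l] u[OF y] u[OF z] in \<open>auto simp: algebra_simps\<close>)
    show "G \<bullet> (z - y) = u z - u y"
      by (rule vector_derivative_unique_within_closed_interval[OF _ _ 1 2]) auto
  qed
qed

text \<open>The tangential gradient is the orthogonal projection of \<open>b\<close> onto the direction space of \<open>K\<close>. Two
  candidates differ by a vector that both lies in that space and is orthogonal to it.\<close>

lemma tangential_gradient_affine:
  fixes K :: "(real^3) set"
  assumes K: "convex K" and u: "\<And>z. z \<in> K \<Longrightarrow> u z = c + b \<bullet> z"
  obtains G where "G \<in> span {z - z' |z z'. z \<in> K \<and> z' \<in> K}"
    "\<And>z z'. z \<in> K \<Longrightarrow> z' \<in> K \<Longrightarrow> G \<bullet> (z - z') = u z - u z'"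
    "\<And>y. y \<in> K \<Longrightarrow> tangential_gradient K u y = G"
proof -
  let ?D = "{z - z' |z z'. z \<in> K \<and> z' \<in> K}"
  obtain G H where G: "G \<in> span ?D" and H: "\<And>w. w \<in> span ?D \<Longrightarrow> orthogonal H w" and b: "b = G + H"
    by (rule orthogonal_subspace_decomp_exists[of ?D b]) blast
  have D: "z - z' \<in> span ?D" if "z \<in> K" "z' \<in> K" for z z'
    using that by (intro span_base) auto
  have diff: "G \<bullet> (z - z') = u z - u z'" if "z \<in> K" "z' \<in> K" for z z'
    using H[OF D[OF that]] u that by (simp add: b orthogonal_def inner_add_left inner_diff_right)
  have "tangential_gradient K u y = G" if y: "y \<in> K" for y
    unfolding tangential_gradient_def
  proof (rule the_equality)
    show "G \<in> span ?D \<and> (u has_derivative (\<lambda>w. G \<bullet> w)) (at y within K)"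
      using G has_derivative_within_affine_iff[OF K y u] diff y by blast
    fix g assume g: "g \<in> span ?D \<and> (u has_derivative (\<lambda>w. g \<bullet> w)) (at y within K)"
    then have gy: "g \<bullet> (z - y) = u z - u y" if "z \<in> K" for z
      using has_derivative_within_affine_iff[OF K y u] that by blast
    have "(g - G) \<bullet> w = 0" if "w \<in> ?D" for w
    proof -
      obtain z z' where w: "w = (z - y) - (z' - y)" and "z \<in> K" "z' \<in> K" using \<open>w \<in> ?D\<close> by auto
      have "(g - G) \<bullet> w = (g \<bullet> (z - y) - G \<bullet> (z - y)) - (g \<bullet> (z' - y) - G \<bullet> (z' - y))"
        unfolding w by (simp add: inner_diff_left inner_diff_right)
      also have "\<dots> = 0"
        unfolding gy[OF \<open>z \<in> K\<close>] gy[OF \<open>z' \<in> K\<close>] diff[OF \<open>z \<in> K\<close> y] diff[OF \<open>z' \<in> K\<close> y] by simp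
      finally show ?thesis .
    qed
    then have perp: "orthogonal (g - G) w" if "w \<in> ?D" for w
      unfolding orthogonal_def using that by blast
    have "g - G \<in> span ?D" by (rule span_diff[OF conjunct1[OF g] G])
    from orthogonal_to_span[OF this perp] show "g = G" by (simp add: orthogonal_def)
  qed
  with G diff that show ?thesis by blast
qed

lemma span_differences_triangle:
  fixes p q v :: "real^3"
  shows "span {z - z' |z z'. z \<in> convex hull {p, q, v} \<and> z' \<in> convex hull {p, q, v}} \<subseteq> span {p - v, q - v}"
proof (rule span_minimal)
  have "convex {z. z - v \<in> span {p - v, q - v}}"
  proof -
    have "z - v \<in> span {p - v, q - v} \<longleftrightarrow> z \<in> (+) v ` span {p - v, q - v}" for z
      by (auto intro!: image_eqI[of z "(+) v" "z - v"])
    then have "{z. z - v \<in> span {p - v, q - v}} = (+) v ` span {p - v, q - v}" by blast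
    then show ?thesis
      by (simp only:) (intro convex_translation subspace_imp_convex subspace_span)
  qed
  then have "convex hull {p, q, v} \<subseteq> {z. z - v \<in> span {p - v, q - v}}"
    by (intro hull_minimal) (auto intro: span_base span_zero)
  then have *: "z - v \<in> span {p - v, q - v}" if "z \<in> convex hull {p, q, v}" for z using that by auto
  show "{z - z' |z z'. z \<in> convex hull {p, q, v} \<and> z' \<in> convex hull {p, q, v}} \<subseteq> span {p - v, q - v}"
  proof clarify
    fix z z' assume "z \<in> convex hull {p, q, v}" "z' \<in> convex hull {p, q, v}"
    from span_diff[OF *[OF this(1)] *[OF this(2)]] show "z - z' \<in> span {p - v, q - v}" by simp
  qed
qed simp

section \<open>The cotangent formula\<close>

text \<open>\<open>G\<close> and \<open>H\<close> act as a dual basis to \<open>a\<close>, \<open>b\<close>. Solving the Gram system for the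
  \<open>b\<close>-coefficient of \<open>G\<close>, which equals \<open>G \<bullet> H\<close>, gives \<open>- (a \<bullet> b)\<close> over the Gram determinant, and that
  determinant is the squared norm of the cross product.\<close>

lemma dual_basis_inner:
  fixes a b G H :: "real^3"
  assumes G: "G \<in> span {a, b}" and Ga: "G \<bullet> a = 1" and Gb: "G \<bullet> b = 0"
    and Ha: "H \<bullet> a = 0" and Hb: "H \<bullet> b = 1"
  shows "(norm (cross3 a b))\<^sup>2 * (G \<bullet> H) = - (a \<bullet> b)"
proof -
  obtain s where "G - s *\<^sub>R a \<in> span {b}" using G by (auto simp: span_insert[of a])
  then obtain t where "G - s *\<^sub>R a = t *\<^sub>R b" by (auto simp: span_singleton)
  then have st: "G = s *\<^sub>R a + t *\<^sub>R b" by (simp add: diff_eq_eq add.commute)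
  have "a \<bullet> H = 0" "b \<bullet> H = 1" using Ha Hb by (simp_all only: inner_commute)
  then have GH: "G \<bullet> H = t" by (simp add: st inner_add_left)
  have "s * (a \<bullet> a) + t * (a \<bullet> b) = 1" "s * (a \<bullet> b) + t * (b \<bullet> b) = 0"
    using Ga Gb by (simp_all add: st inner_add_left inner_commute[of b a])
  then have "(a \<bullet> a) * (s * (a \<bullet> b) + t * (b \<bullet> b)) - (a \<bullet> b) * (s * (a \<bullet> a) + t * (a \<bullet> b)) = - (a \<bullet> b)"
    by simp
  then have "((a \<bullet> a) * (b \<bullet> b) - (a \<bullet> b)\<^sup>2) * t = - (a \<bullet> b)"
    by (simp add: algebra_simps power2_eq_square)
  then show ?thesis by (simp only: GH norm_cross) (simp only: power2_norm_eq_inner)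
qed

text \<open>The fraction on the right is the cotangent of the angle at \<open>v\<close>, and the
  measure of the reference triangle is the usual factor \<open>1/2\<close>.\<close>

lemma triangle_integral_hat_gradients:
  fixes p q v :: "real^3"
  assumes K: "K = convex hull {p, q, v}" and ind: "\<not> collinear {p, q, v}"
    and u: "\<And>z. z \<in> K \<Longrightarrow> u z = c + b \<bullet> z" "u p = 1" "u q = 0" "u v = 0"
    and w: "\<And>z. z \<in> K \<Longrightarrow> w z = c' + b' \<bullet> z" "w p = 0" "w q = 1" "w v = 0"
  shows "triangle_integral K (\<lambda>y. tangential_gradient K u y \<bullet> tangential_gradient K w y) =
    - measure lborel ref_triangle * (((p - v) \<bullet> (q - v)) / norm (cross3 (p - v) (q - v)))"
proof -
  let ?N = "norm (cross3 (p - v) (q - v))"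
  have cvx: "convex K" and vert: "p \<in> K" "q \<in> K" "v \<in> K" by (auto simp: K intro: hull_inc)
  obtain G where G: "G \<in> span {z - z' |z z'. z \<in> K \<and> z' \<in> K}"
    "\<And>z z'. z \<in> K \<Longrightarrow> z' \<in> K \<Longrightarrow> G \<bullet> (z - z') = u z - u z'"
    "\<And>y. y \<in> K \<Longrightarrow> tangential_gradient K u y = G"
    by (rule tangential_gradient_affine[of K u, OF cvx u(1)]) blast+
  obtain H where H: "\<And>z z'. z \<in> K \<Longrightarrow> z' \<in> K \<Longrightarrow> H \<bullet> (z - z') = w z - w z'"
    "\<And>y. y \<in> K \<Longrightarrow> tangential_gradient K w y = H"
    by (rule tangential_gradient_affine[of K w, OF cvx w(1)]) blast+
  have "?N\<^sup>2 * (G \<bullet> H) = - ((p - v) \<bullet> (q - v))"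
    using G(1) span_differences_triangle[of p q v] G(2) H(1) vert u w
    by (intro dual_basis_inner) (auto simp: K)
  then have "?N * (G \<bullet> H) = - (((p - v) \<bullet> (q - v)) / ?N)"
    using norm_cross_pos[OF ind] by (simp add: field_simps power2_eq_square)
  moreover have "triangle_integral K (\<lambda>y. tangential_gradient K u y \<bullet> tangential_gradient K w y) =
      ?N * ((G \<bullet> H) * measure lborel ref_triangle)"
    by (rule triangle_integral_const[OF K ind]) (simp add: G H)
  ultimately show ?thesis by (simp add: mult.assoc[symmetric])
qed

text \<open>The sine follows from Lagrange's identity for the norm of a cross product.\<close>

lemma sin_cos_angle_at:
  fixes p q v :: "real^3"
  assumes "\<not> collinear {p, q, v}"
  shows "cos (angle_at v p q) = ((p - v) \<bullet> (q - v)) / (norm (p - v) * norm (q - v))"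
    and "sin (angle_at v p q) = norm (cross3 (p - v) (q - v)) / (norm (p - v) * norm (q - v))"
    and "0 \<le> angle_at v p q"
proof -
  let ?a = "p - v" and ?b = "q - v"
  let ?c = "(?a \<bullet> ?b) / (norm ?a * norm ?b)"
  have ab: "norm ?a > 0" "norm ?b > 0" using assms by (auto simp: collinear_3_eq_affine_dependent)
  have "\<bar>?c\<bar> \<le> 1" using Cauchy_Schwarz_ineq2[of ?a ?b] ab by (simp add: abs_mult)
  then have c: "-1 \<le> ?c" "?c \<le> 1" by linarith+
  show "cos (angle_at v p q) = ?c" unfolding angle_at_def by (rule cos_arccos[OF c])
  show "0 \<le> angle_at v p q" unfolding angle_at_def by (rule arccos_lbound[OF c])
  have "1 - ?c\<^sup>2 = (norm (cross3 ?a ?b) / (norm ?a * norm ?b))\<^sup>2"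
    using ab unfolding power_divide norm_cross by (simp add: field_simps power_mult_distrib)
  then show "sin (angle_at v p q) = norm (cross3 ?a ?b) / (norm ?a * norm ?b)"
    unfolding angle_at_def sin_arccos[OF c] using ab by (simp add: real_sqrt_abs)
qed

text \<open>Up to positive factors the sum of the two cotangents is \<open>sin (\<alpha> + \<beta>)\<close>, and \<open>\<alpha> + \<beta>\<close> lies between
  \<open>0\<close> and \<open>pi\<close>.\<close>

lemma cotangent_sum_nonneg:
  fixes p q v v' :: "real^3"
  assumes ind: "\<not> collinear {p, q, v}" "\<not> collinear {p, q, v'}"
    and le: "angle_at v p q + angle_at v' p q \<le> pi"
  shows "0 \<le> ((p - v) \<bullet> (q - v)) / norm (cross3 (p - v) (q - v))
           + ((p - v') \<bullet> (q - v')) / norm (cross3 (p - v') (q - v'))"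
proof -
  let ?C = "\<lambda>v. (p - v) \<bullet> (q - v)" and ?N = "\<lambda>v. norm (cross3 (p - v) (q - v))"
  let ?l = "\<lambda>v. norm (p - v) * norm (q - v)"
  have l: "?l v > 0" "?l v' > 0" using ind by (auto simp: collinear_3_eq_affine_dependent)
  have "0 \<le> sin (angle_at v p q + angle_at v' p q)"
    using le sin_cos_angle_at(3)[OF ind(1)] sin_cos_angle_at(3)[OF ind(2)] by (intro sin_ge_zero) auto
  also have "\<dots> = (?N v * ?C v' + ?C v * ?N v') / (?l v * ?l v')"
    unfolding sin_add sin_cos_angle_at(1,2)[OF ind(1)] sin_cos_angle_at(1,2)[OF ind(2)]
    by (simp add: add_divide_distrib)
  finally have "0 \<le> ?N v * ?C v' + ?C v * ?N v'"
    using mult_pos_pos[OF l] by (simp only: zero_le_divide_iff) auto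
  then have "0 \<le> (?N v * ?C v' + ?C v * ?N v') / (?N v * ?N v')"
    by simp
  also have "\<dots> = ?C v / ?N v + ?C v' / ?N v'"
    using norm_cross_pos[OF ind(1)] norm_cross_pos[OF ind(2)] by (simp add: field_simps)
  finally show ?thesis .
qed

section \<open>Signs of the lumped mass and stiffness matrices\<close>

lemma triple_containing_pair:
  assumes "p \<in> {a, b, c}" "q \<in> {a, b, c}" "p \<noteq> q"
  obtains v where "{a, b, c} = {p, q, v}"
proof -
  have "{a, b, c} = {p, q, a} \<or> {a, b, c} = {p, q, b} \<or> {a, b, c} = {p, q, c}"
    using assms by blast
  then show ?thesis using that by blast
qed

lemma two_simplexE:
  fixes K :: "(real^3) set"
  assumes "2 simplex K"
  obtains p q v where "K = convex hull {p, q, v}" "\<not> collinear {p, q, v}"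
    "\<And>z. z extreme_point_of K \<longleftrightarrow> z \<in> {p, q, v}"
proof -
  obtain C where C: "\<not> affine_dependent C" "card C = 3" "K = convex hull C"
    using assms by (auto simp: simplex_def)
  then obtain p q v where "C = {p, q, v}" "p \<noteq> q" "p \<noteq> v" "q \<noteq> v" by (auto simp: card_3_iff)
  with C that[of p q v] show ?thesis
    by (simp add: collinear_3_eq_affine_dependent extreme_point_of_convex_hull_affine_independent)
qed

text \<open>Links the combinatorics of edges to nodes: on a triangle that
  lacks one of the two nodes as a vertex, one of the two nodal basis functions vanishes identically.\<close>

lemma edge_of_triangle_iff:
  fixes p q :: "real^3"
  assumes K: "2 simplex K" and "p \<noteq> q"
  shows "convex hull {p, q} edge_of K \<longleftrightarrow> p extreme_point_of K \<and> q extreme_point_of K"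
proof
  assume "convex hull {p, q} edge_of K"
  then have "convex hull {p, q} face_of K" by (simp add: edge_of_def)
  from extreme_point_of_face[OF this] show "p extreme_point_of K \<and> q extreme_point_of K"
    by (metis extreme_point_of_convex_hull_2)
next
  assume pq: "p extreme_point_of K \<and> q extreme_point_of K"
  obtain C where C: "\<not> affine_dependent C" "K = convex hull C" using K by (auto simp: simplex_def)
  have "{p, q} \<subseteq> C"
    using pq C by (simp add: extreme_point_of_convex_hull_affine_independent)
  then have "convex hull {p, q} face_of K"
    unfolding C(2) face_of_convex_hull_affine_independent[OF C(1)] by blast
  then show "convex hull {p, q} edge_of K"
    using \<open>p \<noteq> q\<close> by (simp add: edge_of_def aff_dim_convex_hull)
qed

lemma affine_eq_const_on_convex_hull:
  fixes u :: "'a::euclidean_space \<Rightarrow> real"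
  assumes u: "\<And>y. y \<in> convex hull C \<Longrightarrow> u y = c + b \<bullet> y" and C: "\<And>z. z \<in> C \<Longrightarrow> u z = a"
    and y: "y \<in> convex hull C"
  shows "u y = a"
proof -
  have "C \<subseteq> {y. b \<bullet> y = a - c}" using u C by (force simp: hull_inc)
  then have "convex hull C \<subseteq> {y. b \<bullet> y = a - c}" by (rule hull_minimal) (rule convex_hyperplane)
  then show ?thesis using u y by force
qed

context
  fixes \<K> :: "(real^3) set set" and x :: "'n::finite \<Rightarrow> real^3" and \<phi> :: "'n \<Rightarrow> real^3 \<Rightarrow> real"
  assumes surface: "closed_triangulated_surface \<K>"
    and vertices: "range x = {v. \<exists>K\<in>\<K>. v extreme_point_of K}"
    and basis: "nodal_basis \<K> x \<phi>"
begin

lemma finite_mesh: "finite \<K>"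
  using surface by (simp add: closed_triangulated_surface_def triangulation_def)

lemma mesh_2_simplex: "K \<in> \<K> \<Longrightarrow> 2 simplex K"
  using surface by (simp add: closed_triangulated_surface_def)

lemma basis_at_node: "\<phi> i (x j) = (if i = j then 1 else 0)"
  using basis by (simp add: nodal_basis_def)

lemma node_inj: "i \<noteq> j \<Longrightarrow> x i \<noteq> x j"
  using basis_at_node[of i i] basis_at_node[of i j] by auto

lemma mesh_vertexE:
  assumes "K \<in> \<K>" "z extreme_point_of K"
  obtains l where "z = x l"
  using assms vertices by blast

lemma basis_affine:
  assumes "K \<in> \<K>"
  obtains c b where "\<And>y. y \<in> K \<Longrightarrow> \<phi> i y = c + b \<bullet> y"
proof -
  have "\<phi> i \<in> fe_space \<K>" using basis by (simp add: nodal_basis_def)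
  then have "\<exists>c b. \<forall>y\<in>K. \<phi> i y = c + b \<bullet> y" using assms by (simp add: fe_space_def)
  then show ?thesis using that by auto
qed

lemma basis_gradient_exists:
  assumes K: "K \<in> \<K>"
  shows "\<exists>G. G \<in> span {z - z' |z z'. z \<in> K \<and> z' \<in> K} \<and>
    (\<forall>z\<in>K. \<forall>z'\<in>K. G \<bullet> (z - z') = \<phi> i z - \<phi> i z') \<and>
    (\<forall>y\<in>K. tangential_gradient K (\<phi> i) y = G)"
proof -
  obtain c b where aff: "\<And>y. y \<in> K \<Longrightarrow> \<phi> i y = c + b \<bullet> y" by (rule basis_affine[OF K, of i]) blast
  have "convex K" using mesh_2_simplex[OF K] by (auto simp: simplex_def)
  then obtain G where "G \<in> span {z - z' |z z'. z \<in> K \<and> z' \<in> K}"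
    "\<And>z z'. z \<in> K \<Longrightarrow> z' \<in> K \<Longrightarrow> G \<bullet> (z - z') = \<phi> i z - \<phi> i z'"
    "\<And>y. y \<in> K \<Longrightarrow> tangential_gradient K (\<phi> i) y = G"
    by (rule tangential_gradient_affine[OF _ aff]) blast+
  then show ?thesis by (intro exI[of _ G]) simp
qed

lemma basis_at_vertex:
  assumes "K \<in> \<K>" "z extreme_point_of K"
  shows "\<phi> i z = (if z = x i then 1 else 0)"
proof -
  obtain l where "z = x l" by (rule mesh_vertexE[OF assms])
  then show ?thesis using node_inj[of i l] by (auto simp: basis_at_node)
qed

lemma basis_zero_off_support:
  assumes K: "K \<in> \<K>" and i: "\<not> x i extreme_point_of K" and y: "y \<in> K"
  shows "\<phi> i y = 0"
proof -
  obtain p q v where T: "K = convex hull {p, q, v}" "\<And>z. z extreme_point_of K \<longleftrightarrow> z \<in> {p, q, v}"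
    by (rule two_simplexE[OF mesh_2_simplex[OF K]]) blast
  obtain c b where aff: "\<And>y. y \<in> K \<Longrightarrow> \<phi> i y = c + b \<bullet> y" by (rule basis_affine[OF K, of i]) blast
  show ?thesis
  proof (rule affine_eq_const_on_convex_hull[of "{p, q, v}" "\<phi> i" c b])
    show "y \<in> convex hull {p, q, v}" using y T by simp
    show "\<phi> i y = c + b \<bullet> y" if "y \<in> convex hull {p, q, v}" for y using aff that T by simp
    show "\<phi> i z = 0" if "z \<in> {p, q, v}" for z
      using that T(2) i basis_at_vertex[OF K, of z i] by auto
  qed
qed

text \<open>The sum is affine on each triangle and equals \<open>1\<close> at its vertices.\<close>

lemma basis_partition_of_unity:
  assumes K: "K \<in> \<K>" and y: "y \<in> K"
  shows "(\<Sum>j\<in>UNIV. \<phi> j y) = 1"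
proof -
  obtain p q v where T: "K = convex hull {p, q, v}" "\<And>z. z extreme_point_of K \<longleftrightarrow> z \<in> {p, q, v}"
    by (rule two_simplexE[OF mesh_2_simplex[OF K]]) blast
  have "\<forall>j. \<exists>cb. \<forall>y\<in>K. \<phi> j y = fst cb + snd cb \<bullet> y"
  proof
    fix j
    obtain c b where "\<And>y. y \<in> K \<Longrightarrow> \<phi> j y = c + b \<bullet> y" by (rule basis_affine[OF K, of j]) blast
    then show "\<exists>cb. \<forall>y\<in>K. \<phi> j y = fst cb + snd cb \<bullet> y" by (intro exI[of _ "(c, b)"]) simp
  qed
  from choice[OF this]
  obtain cb where aff: "\<forall>j. \<forall>y\<in>K. \<phi> j y = fst (cb j) + snd (cb j) \<bullet> y" ..
  show ?thesis
  proof (rule affine_eq_const_on_convex_hull[of "{p, q, v}" "\<lambda>y. \<Sum>j\<in>UNIV. \<phi> j y"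
      "\<Sum>j\<in>UNIV. fst (cb j)" "\<Sum>j\<in>UNIV. snd (cb j)"])
    show "y \<in> convex hull {p, q, v}" using y T by simp
    show "(\<Sum>j\<in>UNIV. \<phi> j y) = (\<Sum>j\<in>UNIV. fst (cb j)) + (\<Sum>j\<in>UNIV. snd (cb j)) \<bullet> y"
      if "y \<in> convex hull {p, q, v}" for y
    proof -
      have "\<phi> j y = fst (cb j) + snd (cb j) \<bullet> y" for j using aff that T(1) by simp
      then show ?thesis by (simp add: sum.distrib inner_sum_left)
    qed
    show "(\<Sum>j\<in>UNIV. \<phi> j z) = 1" if z: "z \<in> {p, q, v}" for z
    proof -
      have "z extreme_point_of K" using T(2) z by blast
      then obtain l where "z = x l" by (rule mesh_vertexE[OF K])
      then show ?thesis by (simp add: basis_at_node)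
    qed
  qed
qed

lemma triangle_integral_zero: "triangle_integral K (\<lambda>_. 0) = 0"
  unfolding triangle_integral_def Let_def case_prod_unfold set_lebesgue_integral_def by simp

text \<open>Interpolation replaces \<open>\<phi> i * \<phi> j\<close> by its nodal values, which vanish for \<open>i \<noteq> j\<close> and reproduce
  \<open>\<phi> i\<close> for \<open>i = j\<close>.\<close>

lemma lumped_mass_entry:
  "lumped_mass_matrix \<K> x \<phi> $ i $ j = (if i = j then \<Sum>K\<in>\<K>. triangle_integral K (\<phi> i) else 0)"
proof -
  have "interpolant x \<phi> (\<lambda>y. \<phi> i y * \<phi> j y) = (\<lambda>y. if i = j then \<phi> i y else 0)"
  proof
    fix y
    have "\<phi> i (x l) * \<phi> j (x l) * \<phi> l y = (if l = i then (if i = j then \<phi> i y else 0) else 0)" for l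
      by (simp add: basis_at_node)
    then show "interpolant x \<phi> (\<lambda>y. \<phi> i y * \<phi> j y) y = (if i = j then \<phi> i y else 0)"
      by (simp add: interpolant_def)
  qed
  then show ?thesis
    by (simp add: lumped_mass_matrix_def surface_integral_def triangle_integral_zero)
qed

lemma lumped_mass_diagonal_pos: "lumped_mass_matrix \<K> x \<phi> $ i $ i > 0"
proof -
  have sign: "triangle_integral K (\<phi> i) \<ge> 0 \<and> (x i extreme_point_of K \<longrightarrow> triangle_integral K (\<phi> i) > 0)"
    if K: "K \<in> \<K>" for K
  proof -
    obtain p q v where T: "K = convex hull {p, q, v}" "\<not> collinear {p, q, v}"
      "\<And>z. z extreme_point_of K \<longleftrightarrow> z \<in> {p, q, v}"
      by (rule two_simplexE[OF mesh_2_simplex[OF K]]) blast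
    show ?thesis
    proof (cases "x i extreme_point_of K")
      case True
      obtain c b where aff: "\<And>y. y \<in> K \<Longrightarrow> \<phi> i y = c + b \<bullet> y" by (rule basis_affine[OF K, of i]) blast
      have "triangle_integral K (\<phi> i) > 0"
      proof (rule triangle_integral_affine_pos[OF T(1,2) aff])
        show "\<phi> i z \<ge> 0" if "z \<in> {p, q, v}" for z
          using that T(3) basis_at_vertex[OF K, of z i] by simp
        show "x i \<in> {p, q, v}" using True T(3) by simp
        show "\<phi> i (x i) > 0" by (simp add: basis_at_node)
      qed
      then show ?thesis by simp
    next
      case False
      then show ?thesis
        using triangle_integral_const[OF T(1,2), of "\<phi> i" 0] basis_zero_off_support[OF K] by simp
    qed
  qed
  obtain K where "K \<in> \<K>" "x i extreme_point_of K" using vertices by blast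
  then show ?thesis
    unfolding lumped_mass_entry using sign finite_mesh by (auto intro!: sum_pos2)
qed

text \<open>The basis functions sum to a constant, so their gradients on a triangle sum to zero. The sum is
  a tangent vector orthogonal to all tangent directions.\<close>

lemma stiffness_row_sum: "(\<Sum>j\<in>UNIV. stiffness_matrix \<K> \<phi> $ i $ j) = 0"
proof -
  let ?I = "\<lambda>K j. triangle_integral K (\<lambda>y. tangential_gradient K (\<phi> i) y \<bullet> tangential_gradient K (\<phi> j) y)"
  have "(\<Sum>j\<in>UNIV. ?I K j) = 0" if K: "K \<in> \<K>" for K
  proof -
    let ?D = "{z - z' |z z'. z \<in> K \<and> z' \<in> K}"
    obtain p q v where T: "K = convex hull {p, q, v}" "\<not> collinear {p, q, v}"
      by (rule two_simplexE[OF mesh_2_simplex[OF K]]) blast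
    have "\<forall>j. \<exists>G. G \<in> span ?D \<and> (\<forall>z\<in>K. \<forall>z'\<in>K. G \<bullet> (z - z') = \<phi> j z - \<phi> j z') \<and>
        (\<forall>y\<in>K. tangential_gradient K (\<phi> j) y = G)"
      using basis_gradient_exists[OF K] ..
    from choice[OF this] obtain G where "\<forall>j. G j \<in> span ?D \<and>
        (\<forall>z\<in>K. \<forall>z'\<in>K. G j \<bullet> (z - z') = \<phi> j z - \<phi> j z') \<and>
        (\<forall>y\<in>K. tangential_gradient K (\<phi> j) y = G j)" ..
    then have G: "G j \<in> span ?D"
      "z \<in> K \<Longrightarrow> z' \<in> K \<Longrightarrow> G j \<bullet> (z - z') = \<phi> j z - \<phi> j z'"
      "y \<in> K \<Longrightarrow> tangential_gradient K (\<phi> j) y = G j" for j z z' y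
      by simp_all
    let ?S = "\<Sum>j\<in>UNIV. G j"
    have "?S \<bullet> w = 0" if wD: "w \<in> ?D" for w
    proof -
      obtain z z' where w: "w = z - z'" "z \<in> K" "z' \<in> K" using wD by auto
      then have "?S \<bullet> w = (\<Sum>j\<in>UNIV. \<phi> j z) - (\<Sum>j\<in>UNIV. \<phi> j z')"
        by (simp add: inner_sum_left G(2) sum_subtractf)
      then show ?thesis using w by (simp add: basis_partition_of_unity[OF K])
    qed
    then have perp: "orthogonal ?S w" if "w \<in> ?D" for w unfolding orthogonal_def using that by blast
    have "(\<Sum>j\<in>UNIV. G i \<bullet> G j) = G i \<bullet> ?S" by (simp only: inner_sum_right)
    also have "\<dots> = 0"
      using orthogonal_to_span[OF G(1) perp] by (simp only: orthogonal_def inner_commute)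
    finally have "(\<Sum>j\<in>UNIV. G i \<bullet> G j) = 0" .
    moreover have "?I K j = norm (cross3 (p - v) (q - v)) * ((G i \<bullet> G j) * measure lborel ref_triangle)" for j
      by (rule triangle_integral_const[OF T]) (simp add: G(3))
    ultimately show ?thesis
      by (simp add: sum_distrib_left[symmetric] sum_distrib_right[symmetric])
  qed
  then have "(\<Sum>K\<in>\<K>. \<Sum>j\<in>UNIV. ?I K j) = 0" by simp
  then show ?thesis
    unfolding stiffness_matrix_def surface_integral_def vec_lambda_beta
    by (subst sum.swap)
qed

text \<open>Only the triangles that have the segment between the two nodes as an edge contribute. On a
  closed surface there are two of them or none, and their contributions are minus the cotangents
  of the two angles opposite to that edge, up to a common factor.\<close>

lemma stiffness_offdiagonal_nonpos:
  assumes angle: "angle_condition \<K>" and "i \<noteq> j"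
  shows "stiffness_matrix \<K> \<phi> $ i $ j \<le> 0"
proof -
  let ?p = "x i" and ?q = "x j"
  let ?I = "\<lambda>K. triangle_integral K (\<lambda>y. tangential_gradient K (\<phi> i) y \<bullet> tangential_gradient K (\<phi> j) y)"
  let ?\<kappa> = "measure lborel ref_triangle"
  let ?cot = "\<lambda>v. ((?p - v) \<bullet> (?q - v)) / norm (cross3 (?p - v) (?q - v))"
  let ?S = "{K\<in>\<K>. convex hull {?p, ?q} edge_of K}"
  have pq: "?p \<noteq> ?q" using node_inj \<open>i \<noteq> j\<close> by blast
  have inside: "\<exists>v. K = convex hull {?p, ?q, v} \<and> \<not> collinear {?p, ?q, v} \<and> ?I K = - ?\<kappa> * ?cot v"
    if "K \<in> ?S" for K
  proof -
    have K: "K \<in> \<K>" "2 simplex K" and ext: "?p extreme_point_of K" "?q extreme_point_of K"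
      using that edge_of_triangle_iff[OF mesh_2_simplex pq, of K] mesh_2_simplex by auto
    obtain a b c where T: "K = convex hull {a, b, c}" "\<not> collinear {a, b, c}"
      "\<And>z. z extreme_point_of K \<longleftrightarrow> z \<in> {a, b, c}"
      by (rule two_simplexE[OF K(2)]) blast
    obtain v where v: "{a, b, c} = {?p, ?q, v}"
      using triple_containing_pair[OF _ _ pq] ext unfolding T(3) by metis
    then have ind: "\<not> collinear {?p, ?q, v}" and hull: "K = convex hull {?p, ?q, v}" using T by auto
    then have vpq: "v \<noteq> ?p" "v \<noteq> ?q" by (auto simp: collinear_3_eq_affine_dependent)
    have vext: "v extreme_point_of K" using T(3) v by auto
    obtain c b where aff: "\<And>y. y \<in> K \<Longrightarrow> \<phi> i y = c + b \<bullet> y"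
      by (rule basis_affine[OF K(1), of i]) blast
    obtain c' b' where aff': "\<And>y. y \<in> K \<Longrightarrow> \<phi> j y = c' + b' \<bullet> y"
      by (rule basis_affine[OF K(1), of j]) blast
    have "?I K = - ?\<kappa> * ?cot v"
      by (rule triangle_integral_hat_gradients[OF hull ind aff _ _ _ aff'])
         (use \<open>i \<noteq> j\<close> vpq basis_at_vertex[OF K(1) vext] in \<open>auto simp: basis_at_node\<close>)
    with ind hull show ?thesis by blast
  qed
  have outside: "?I K = 0" if K: "K \<in> \<K>" "K \<notin> ?S" for K
  proof -
    obtain p q v where T: "K = convex hull {p, q, v}" "\<not> collinear {p, q, v}"
      by (rule two_simplexE[OF mesh_2_simplex[OF K(1)]]) blast
    have "\<exists>l\<in>{i, j}. \<not> x l extreme_point_of K"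
      using K edge_of_triangle_iff[OF mesh_2_simplex pq, of K] by auto
    then obtain l where l: "l \<in> {i, j}" "\<And>y. y \<in> K \<Longrightarrow> \<phi> l y = 0"
      using basis_zero_off_support[OF K(1)] by blast
    have "tangential_gradient K (\<phi> l) y = 0" if y: "y \<in> K" for y
    proof -
      obtain G where G: "G \<in> span {z - z' |z z'. z \<in> K \<and> z' \<in> K}"
        "\<forall>z\<in>K. \<forall>z'\<in>K. G \<bullet> (z - z') = \<phi> l z - \<phi> l z'"
        "\<forall>y\<in>K. tangential_gradient K (\<phi> l) y = G"
        using basis_gradient_exists[OF K(1), of l] by (elim exE conjE)
      have "orthogonal G w" if "w \<in> {z - z' |z z'. z \<in> K \<and> z' \<in> K}" for w
        using that G(2) l(2) by (auto simp: orthogonal_def)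
      from orthogonal_to_span[OF G(1) this] show ?thesis
        using G(3) y by (simp add: orthogonal_def)
    qed
    then show ?thesis
      using triangle_integral_const[OF T, of _ 0] l(1) by auto
  qed
  have "stiffness_matrix \<K> \<phi> $ i $ j = (\<Sum>K\<in>\<K>. ?I K)"
    by (simp add: stiffness_matrix_def surface_integral_def)
  also have "\<dots> = (\<Sum>K\<in>?S. ?I K)"
    by (rule sum.mono_neutral_right) (use finite_mesh outside in auto)
  also have "\<dots> \<le> 0"
  proof (cases "?S = {}")
    case False
    then have "card ?S = 2" using surface unfolding closed_triangulated_surface_def by auto
    then obtain K K' where S: "?S = {K, K'}" "K \<noteq> K'" by (auto simp: card_2_iff)
    obtain v where v: "K = convex hull {?p, ?q, v}" "\<not> collinear {?p, ?q, v}" "?I K = - ?\<kappa> * ?cot v"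
      using inside[of K] S by blast
    obtain v' where v': "K' = convex hull {?p, ?q, v'}" "\<not> collinear {?p, ?q, v'}" "?I K' = - ?\<kappa> * ?cot v'"
      using inside[of K'] S by blast
    have "K \<in> \<K>" "K' \<in> \<K>" using S by auto
    with angle S(2) v(1) v'(1) have "angle_at v ?p ?q + angle_at v' ?p ?q \<le> pi"
      unfolding angle_condition_def by blast
    then have "0 \<le> ?\<kappa> * (?cot v + ?cot v')"
      using cotangent_sum_nonneg[OF v(2) v'(2)] by simp
    then show ?thesis unfolding S(1) using S(2) v(3) v'(3) by (simp add: distrib_left)
  next
    case True
    then show ?thesis by (simp only: sum.empty)
  qed
  finally show ?thesis .
qed

end

section \<open>Invariance of the hyper-rectangle\<close>

theorem theorem5:
  fixes \<Gamma> W :: "(real^3) set" and sd :: "real^3 \<Rightarrow> real" and a :: "real^3 \<Rightarrow> real^3"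
    and h :: real and \<K> :: "(real^3) set set"
    and x :: "'n::finite \<Rightarrow> real^3" and \<phi> :: "'n \<Rightarrow> real^3 \<Rightarrow> real"
    and f :: "real^('r::finite) \<Rightarrow> real^'r" and d :: "'r \<Rightarrow> real" and \<tau> :: real
    and m M :: "'r \<Rightarrow> ereal" and \<Sigma> :: "(real^'r) set" and L :: "'r \<Rightarrow> real"
    and \<xi> :: "nat \<Rightarrow> 'r \<Rightarrow> real^'n"
  assumes "level_set_surface \<Gamma> W sd a"
    and "h > 0"
    and "surface_mesh \<Gamma> W a h \<K> x"
    and "angle_condition \<K>"
    and "nodal_basis \<K> x \<phi>"
    and "\<And>k. d k > 0"
    and "\<tau> > 0"
    and "\<And>k. C_diff_on 2 (\<lambda>u. f u $ k) UNIV"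
    and "\<Sigma> = hyper_rectangle m M"
    and "\<And>u \<nu>. u \<in> frontier \<Sigma> \<Longrightarrow> \<nu> \<in> outward_normals m M u \<Longrightarrow> f u \<bullet> \<nu> \<le> 0"
    and "\<And>k. \<exists>C. C-lipschitz_on \<Sigma> (\<lambda>u. f u $ k)"
    and "\<And>k. L k = lipschitz_constant (\<lambda>u. f u $ k) \<Sigma>"
    and "(\<exists>k. L k \<noteq> 0) \<Longrightarrow> \<tau> \<le> 1 / Max (range L)"
    and "\<And>n k. \<xi> (Suc n) k =
           matrix_inv (lumped_mass_matrix \<K> x \<phi> + (d k * \<tau>) *\<^sub>R stiffness_matrix \<K> \<phi>) *v
             (lumped_mass_matrix \<K> x \<phi> *v (\<xi> n k + \<tau> *\<^sub>R nodal_reaction f (\<xi> n) k))"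
    and "\<And>i. nodal_state (\<xi> 0) i \<in> \<Sigma>"
  shows "\<forall>n i. nodal_state (\<xi> n) i \<in> \<Sigma>"
proof -
  let ?D = "lumped_mass_matrix \<K> x \<phi>"
  have mesh: "closed_triangulated_surface \<K>" "range x = {v. \<exists>K\<in>\<K>. v extreme_point_of K}"
    using assms(3) by (auto simp: surface_mesh_def)
  note discretisation = mesh assms(5)
  note positive = lumped_mass_diagonal_pos[OF discretisation]
    and row_sums = stiffness_row_sum[OF discretisation]
    and nonpositive = stiffness_offdiagonal_nonpos[OF discretisation assms(4)]
  have off_diagonal: "?D $ p $ q = 0" if "p \<noteq> q" for p q
    using that by (simp add: lumped_mass_entry[OF discretisation])
  have lip: "(L k)-lipschitz_on \<Sigma> (\<lambda>u. f u $ k)" for k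
    unfolding assms(12) by (rule lipschitz_on_lipschitz_constant[OF assms(11)])
  have \<tau>L: "\<tau> * L k \<le> 1" for k
  proof (cases "L k = 0")
    case False
    then have "L k > 0" using lipschitz_on_nonneg[OF lip[of k]] by simp
    have max: "L k \<le> Max (range L)" by (rule Max_ge) auto
    with \<open>L k > 0\<close> have "Max (range L) > 0" by linarith
    moreover have "\<tau> \<le> 1 / Max (range L)" by (rule assms(13)) (use False in blast)
    ultimately have "\<tau> * Max (range L) \<le> 1" by (simp add: pos_le_divide_eq)
    with mult_left_mono[OF max, of \<tau>] assms(7) show ?thesis by linarith
  qed simp
  have "\<forall>i. nodal_state (\<xi> n) i \<in> \<Sigma>" for n
  proof (induction n)
    case 0
    then show ?case using assms(15) by blast
  next
    case (Suc n)
    have "m k \<le> ereal (\<xi> (Suc n) k $ i) \<and> ereal (\<xi> (Suc n) k $ i) \<le> M k" for k i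
    proof -
      let ?w = "\<xi> n k + \<tau> *\<^sub>R nodal_reaction f (\<xi> n) k"
      have w: "m k \<le> ereal (?w $ j)" "ereal (?w $ j) \<le> M k" for j
        using reaction_step_in_hyper_rectangle[OF assms(10)[unfolded assms(9)] lip[unfolded assms(9)]
            assms(7) \<tau>L, of "nodal_state (\<xi> n) j" k] Suc.IH
        by (simp_all add: assms(9) nodal_reaction_def nodal_state_def)
      have c: "d k * \<tau> \<ge> 0" using assms(6)[of k] assms(7) by simp
      have upper: "\<xi> (Suc n) k $ i \<le> b" if "\<And>j. ?w $ j \<le> b" for b
        by (rule lumped_step_bounds(1)[OF _ _ _ _ c assms(14)],
            rule positive, erule off_diagonal, rule row_sums, erule nonpositive, rule that)
      have lower: "b \<le> \<xi> (Suc n) k $ i" if "\<And>j. b \<le> ?w $ j" for b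
        by (rule lumped_step_bounds(2)[OF _ _ _ _ c assms(14)],
            rule positive, erule off_diagonal, rule row_sums, erule nonpositive, rule that)
      have "m k \<le> ereal (\<xi> (Suc n) k $ i)"
      proof (cases "m k")
        case (real b)
        then have "b \<le> ?w $ j" for j using w(1)[of j] by simp
        then have "b \<le> \<xi> (Suc n) k $ i" by (rule lower)
        then show ?thesis using real by simp
      qed (use w(1)[of i] in auto)
      moreover have "ereal (\<xi> (Suc n) k $ i) \<le> M k"
      proof (cases "M k")
        case (real b)
        then have "?w $ j \<le> b" for j using w(2)[of j] by simp
        then have "\<xi> (Suc n) k $ i \<le> b" by (rule upper)
        then show ?thesis using real by simp
      qed (use w(2)[of i] in auto)
      ultimately show ?thesis ..
    qed
    then show ?case by (simp add: assms(9) hyper_rectangle_def nodal_state_def)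
  qed
  then show ?thesis by blast
qed

end
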